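(* For a Hermitian matrix $Z\in\mathbb{C}^{n\times n}$ with signature $(\pi(Z),\nu(Z),\delta(Z))$, $$\min\left\{\operatorname{rank}(S)\;\middle|\; S\in\mathbb{C}^{n\times n},\; Z=S+S^*\right\}=\max\{\pi(Z),\nu(Z)\}.$$
   Context: For a Hermitian matrix $Z$, the numbers $\pi(Z)$, $\nu(Z)$, $\delta(Z)$ denote the number of positive, negative, and zero eigenvalues of $Z$ (counted with multiplicity), respectively; the triple $(\pi(Z),\nu(Z),\delta(Z))$ is the signature of $Z$. $S^*$ denotes the complex conjugate transpose of $S$. *)

theory Defs
  imports
    "Jordan_Normal_Form.Schur_Decomposition"
    "Jordan_Normal_Form.DL_Rank"
begin

definition hermitian_mat :: "complex mat \<Rightarrow> bool" where
  "hermitian_mat Z \<longleftrightarrow> square_mat Z \<and> mat_adjoint Z = Z"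

text \<open>
  Multiplicities are algebraic: the multiplicity of an eigenvalue is its order as a root of
  the characteristic polynomial. The eigenvalues of a Hermitian matrix are real, so
  ranging over real numbers omits none of them.
\<close>

definition pos_eigenvalues_count :: "complex mat \<Rightarrow> nat" where
  "pos_eigenvalues_count Z =
    (\<Sum>x :: real | eigenvalue Z (complex_of_real x) \<and> x > 0.
       order (complex_of_real x) (char_poly Z))"

definition neg_eigenvalues_count :: "complex mat \<Rightarrow> nat" where
  "neg_eigenvalues_count Z =
    (\<Sum>x :: real | eigenvalue Z (complex_of_real x) \<and> x < 0.
       order (complex_of_real x) (char_poly Z))"

definition zero_eigenvalues_count :: "complex mat \<Rightarrow> nat" where
  "zero_eigenvalues_count Z = order 0 (char_poly Z)"

definition signature :: "complex mat \<Rightarrow> nat \<times> nat \<times> nat" where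
  "signature Z =
    (pos_eigenvalues_count Z, neg_eigenvalues_count Z, zero_eigenvalues_count Z)"

end

theory Submission
  imports Defs
begin

text \<open>
  By the spectral theorem, \<open>Z = U D U\<^sup>*\<close> with \<open>U\<close> unitary and \<open>D\<close> real diagonal, and the diagonal
  of \<open>D\<close> has \<open>p\<close> positive and \<open>q\<close> negative entries.

  The rank of \<open>S\<close> cannot be smaller than \<open>p\<close> or \<open>q\<close>: the quadratic form
  \<open>x\<^sup>* Z x = x\<^sup>* S x + x\<^sup>* S\<^sup>* x\<close> vanishes on the kernel of \<open>S\<close>, but it is positive definite on the
  span of the eigenvectors with positive eigenvalues, a space of dimension \<open>p\<close>, and negative
  definite on the corresponding space of dimension \<open>q\<close>. Each of these spaces therefore meets the
  kernel only in \<open>0\<close>, so that \<open>S\<close> is injective on it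
  (\<open>definite_index_set_card_le_rank\<close>).

  The bound is attained because a positive and a negative square can be absorbed together
  in one rank one matrix:
  \<open>a a\<^sup>* - b b\<^sup>* = s + s\<^sup>*\<close> for \<open>s = (a + b) (a - b)\<^sup>* / 2\<close>. Since \<open>Z\<close> is a sum of \<open>p\<close> positive
  and \<open>q\<close> negative squares, pairing them off takes \<open>max p q\<close> matrices of rank one
  (\<open>low_rank_splitting\<close>, \<open>splitting_of_rank_max_inertia\<close>).
\<close>

section \<open>Rank and kernels\<close>

text \<open>
  Rank is subadditive, and each summand of the matrix is the product of a column and a row.
\<close>

lemma sum_of_rank_one_rank_le:
  fixes a :: "nat \<Rightarrow> nat \<Rightarrow> 'a :: field"
  shows "vec_space.rank n (mat n c (\<lambda>(i, j). \<Sum>k<m. a i k * b k j)) \<le> m"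
proof (induction m)
  case 0
  have "mat n c (\<lambda>(i, j). \<Sum>k<0. a i k * b k j) = 0\<^sub>m n c"
    by (intro eq_matI) auto
  then show ?case
    by (simp only: vec_space.rank_0I order_refl)
next
  case (Suc m)
  let ?M = "mat n c (\<lambda>(i, j). \<Sum>k<m. a i k * b k j)"
  let ?L = "mat n c (\<lambda>(i, j). a i m * b m j)"
  have "vec_space.rank n (?M + ?L) \<le> vec_space.rank n ?M + vec_space.rank n ?L"
    by (rule vec_space.rank_subadditive) auto
  moreover have "vec_space.rank n ?L \<le> 1"
    by (rule vec_space.rank_le_1_product_entries[of _ n c "\<lambda>i. a i m" "b m"]) auto
  moreover have eq: "mat n c (\<lambda>(i, j). \<Sum>k<Suc m. a i k * b k j) = ?M + ?L"
    by (intro eq_matI) auto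
  moreover have "vec_space.rank n ?M \<le> m"
    using Suc.IH by (simp only:)
  ultimately have "vec_space.rank n (mat n c (\<lambda>(i, j). \<Sum>k<Suc m. a i k * b k j)) \<le> Suc m"
    unfolding eq by linarith
  then show ?case
    by (simp only:)
qed

text \<open>
  The columns of \<open>A\<close> are a maximal independent set of columns of \<open>S\<close>. There are
  \<open>rank S\<close> of them, and the columns of \<open>B\<close> hold the coordinates of all columns of
  \<open>S\<close> with respect to them.
\<close>

lemma rank_factorization:
  fixes S :: "'a :: field mat"
  assumes S: "S \<in> carrier_mat n c"
  obtains A B where "A \<in> carrier_mat n (vec_space.rank n S)"
    and "B \<in> carrier_mat (vec_space.rank n S) c" and "S = A * B"
proof -
  interpret vec_space "TYPE('a)" n .
  have cols: "set (cols S) \<subseteq> carrier_vec n"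
    using S cols_dim by blast
  obtain U where max: "maximal U (\<lambda>T. T \<subseteq> set (cols S) \<and> lin_indpt T)" and fin: "finite U"
    using maximal_exists_superset[of "set (cols S)" "\<lambda>T. T \<subseteq> set (cols S) \<and> lin_indpt T" "{}"]
    by (metis (no_types, lifting) List.finite_set empty_subsetI finite_lin_indpt2 finite.emptyI
        LinearCombinations.module.finite_lin_dep module_axioms empty_iff)
  have U: "U \<subseteq> set (cols S)" "lin_indpt U"
    using max by (auto simp: maximal_def)
  then have Uc: "U \<subseteq> carrier_vec n"
    using cols by blast
  obtain us where us: "set us = U" "distinct us"
    using fin finite_distinct_list by blast
  have len: "length us = rank S"
    using rank_card_indpt[OF S max] us distinct_card by fastforce
  have span: "v \<in> span (set us)" if "v \<in> set (cols S)" for v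
  proof (cases "v \<in> U")
    case True
    then show ?thesis using span_mem Uc us by auto
  next
    case False
    then have "lin_dep (U \<union> {v})"
      using max U that unfolding maximal_def by blast
    then show ?thesis
      using lin_dep_iff_in_span[of U v] Uc U False cols that us by auto
  qed
  have "\<exists>x \<in> carrier_vec (rank S). col S j = mat_of_cols n us *\<^sub>v x" if "j < c" for j
  proof -
    have "col S j \<in> set (cols S)"
      using that S by (metis carrier_matD(2) cols_length cols_nth nth_mem)
    then have "col S j \<in> span_list us"
      using span span_list_as_span Uc us by auto
    then obtain f where "col S j = lincomb_list f us"
      by (auto simp: span_list_def)
    also have "\<dots> = mat_of_cols n us *\<^sub>v vec (length us) f"
      by (rule lincomb_list_as_mat_mult) (use Uc us in auto)
    finally show ?thesis
      using len by auto
  qed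
  then obtain x where x: "\<And>j. j < c \<Longrightarrow> x j \<in> carrier_vec (rank S)"
    "\<And>j. j < c \<Longrightarrow> col S j = mat_of_cols n us *\<^sub>v x j"
    by metis
  let ?A = "mat_of_cols n us"
  let ?B = "mat_of_cols (rank S) (map x [0..<c])"
  have A: "?A \<in> carrier_mat n (rank S)"
    using len by auto
  have B: "?B \<in> carrier_mat (rank S) c"
    by auto
  have "S = ?A * ?B"
  proof (rule mat_col_eqI)
    fix j assume "j < dim_col (?A * ?B)"
    then have j: "j < c" by simp
    have "col (?A * ?B) j = ?A *\<^sub>v col ?B j"
      using j A B by (intro col_mult2) auto
    also have "col ?B j = x j"
      using j x by (subst col_mat_of_cols) auto
    finally show "col S j = col (?A * ?B) j"
      using x j by simp
  qed (use S in auto)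
  then show ?thesis
    using that A B by blast
qed

text \<open>
  Zero rows that fill the matrix up to a square one leave the kernel as it is and make the
  determinant vanish.
\<close>

lemma wide_matrix_kernel:
  fixes B :: "'a :: field mat"
  assumes B: "B \<in> carrier_mat r k" and "r < k"
  obtains y where "y \<in> carrier_vec k" "y \<noteq> 0\<^sub>v k" "B *\<^sub>v y = 0\<^sub>v r"
proof -
  \<comment> \<open>Row \<open>r\<close> is singled out so that the zero row has the syntactic form of \<open>det_row_0\<close>.\<close>
  let ?C = "mat\<^sub>r k k (\<lambda>i. if i = r then 0\<^sub>v k else if i < r then row B i else 0\<^sub>v k)"
  have "det ?C = 0"
    by (rule det_row_0) (use assms in auto)
  then obtain y where y: "y \<in> carrier_vec k" "y \<noteq> 0\<^sub>v k" "?C *\<^sub>v y = 0\<^sub>v k"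
    using det_0_iff_vec_prod_zero_field[of ?C k] by auto
  have "B *\<^sub>v y = 0\<^sub>v r"
  proof (rule eq_vecI)
    fix i assume "i < dim_vec (0\<^sub>v r :: 'a vec)"
    then have i: "i < r" by simp
    then have "row ?C i = row B i"
      using assms by (subst row_mat_of_row_fun) auto
    moreover have "(?C *\<^sub>v y) $ i = 0"
      unfolding y(3) using i assms by auto
    ultimately show "(B *\<^sub>v y) $ i = 0\<^sub>v r $ i"
      using i assms by auto
  qed (use assms in auto)
  with y that show ?thesis by blast
qed

text \<open>
  Only the columns with index in \<open>J\<close> act on a vector supported in \<open>J\<close>, and these form
  a matrix with more columns than rows.
\<close>

lemma supported_kernel_vector:
  fixes C :: "'a :: field mat"
  assumes C: "C \<in> carrier_mat r n" and J: "J \<subseteq> {..<n}" and "r < card J"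
  obtains w where "w \<in> carrier_vec n" "w \<noteq> 0\<^sub>v n" "\<And>i. i < n \<Longrightarrow> i \<notin> J \<Longrightarrow> w $ i = 0"
    "C *\<^sub>v w = 0\<^sub>v r"
proof -
  have fin: "finite J"
    using J finite_subset by blast
  obtain e where e: "bij_betw e {..<card J} J"
    using ex_bij_betw_nat_finite[OF fin] by (auto simp: atLeast0LessThan)
  let ?g = "the_inv_into {..<card J} e"
  have g: "?g (e k) = k" if "k < card J" for k
    using e that by (intro the_inv_into_f_f) (auto simp: bij_betw_def)
  have eJ: "e k \<in> J" if "k < card J" for k
    using e that by (auto simp: bij_betw_def)
  let ?D = "mat r (card J) (\<lambda>(i, k). C $$ (i, e k))"
  obtain y where y: "y \<in> carrier_vec (card J)" "y \<noteq> 0\<^sub>v (card J)" "?D *\<^sub>v y = 0\<^sub>v r"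
    using wide_matrix_kernel[of ?D r "card J"] assms by auto
  define w where "w = vec n (\<lambda>i. if i \<in> J then y $ ?g i else 0)"
  have we: "w $ e k = y $ k" if "k < card J" for k
    using eJ[OF that] J g[OF that] by (auto simp: w_def)
  obtain k where k: "k < card J" "y $ k \<noteq> 0"
    using y by (metis carrier_vecD eq_vecI index_zero_vec)
  have "e k < n" "w $ e k \<noteq> 0"
    using k we eJ J by auto
  then have "w \<noteq> 0\<^sub>v n" by auto
  moreover have "C *\<^sub>v w = 0\<^sub>v r"
  proof (rule eq_vecI)
    fix i assume "i < dim_vec (0\<^sub>v r :: 'a vec)"
    then have i: "i < r" by simp
    have "(C *\<^sub>v w) $ i = (\<Sum>l<n. C $$ (i, l) * w $ l)"
      using i C by (auto simp: scalar_prod_def w_def atLeast0LessThan)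
    also have "\<dots> = (\<Sum>l\<in>J. C $$ (i, l) * w $ l)"
      using J by (intro sum.mono_neutral_right) (auto simp: w_def)
    also have "\<dots> = (\<Sum>k<card J. C $$ (i, e k) * w $ e k)"
      by (rule sum.reindex_bij_betw[OF e, symmetric])
    also have "\<dots> = (?D *\<^sub>v y) $ i"
      using i y(1) we by (auto simp: scalar_prod_def atLeast0LessThan)
    also have "\<dots> = 0" unfolding y(3) using i by simp
    finally show "(C *\<^sub>v w) $ i = 0\<^sub>v r $ i"
      using i by simp
  qed (use C in auto)
  ultimately show ?thesis
    by (intro that[of w]) (auto simp: w_def)
qed

section \<open>The spectral theorem for Hermitian matrices\<close>

lemma mat_adjoint_dim [simp]:
  "dim_row (mat_adjoint A) = dim_col A" "dim_col (mat_adjoint A) = dim_row A"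
  by (auto simp: mat_adjoint_def)

lemma mat_adjoint_carrier [simp]: "A \<in> carrier_mat m n \<Longrightarrow> mat_adjoint A \<in> carrier_mat n m"
  by (auto intro: carrier_matI)

lemma mat_adjoint_index [simp]:
  fixes A :: "complex mat"
  shows "i < dim_col A \<Longrightarrow> j < dim_row A \<Longrightarrow> mat_adjoint A $$ (i, j) = cnj (A $$ (j, i))"
  by (simp add: mat_adjoint_def mat_of_rows_index)

lemma mat_adjoint_adjoint [simp]:
  fixes A :: "complex mat"
  shows "mat_adjoint (mat_adjoint A) = A"
  by (rule eq_matI) auto

lemma mat_adjoint_mult:
  fixes A :: "complex mat"
  assumes "A \<in> carrier_mat m k" "B \<in> carrier_mat k n"
  shows "mat_adjoint (A * B) = mat_adjoint B * mat_adjoint A"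
  by (rule eq_matI) (use assms in \<open>auto simp: scalar_prod_def mult.commute intro!: sum.cong\<close>)

lemma adjoint_cscalar_prod:
  fixes A :: "complex mat"
  assumes A: "A \<in> carrier_mat m n" and v: "v \<in> carrier_vec m" and w: "w \<in> carrier_vec n"
  shows "(mat_adjoint A *\<^sub>v v) \<bullet>c w = v \<bullet>c (A *\<^sub>v w)"
proof -
  have "(mat_adjoint A *\<^sub>v v) \<bullet>c w = (\<Sum>i<n. \<Sum>j<m. cnj (A $$ (j, i)) * v $ j * cnj (w $ i))"
    using assms by (auto simp: scalar_prod_def atLeast0LessThan sum_distrib_right)
  also have "\<dots> = (\<Sum>j<m. \<Sum>i<n. cnj (A $$ (j, i)) * v $ j * cnj (w $ i))"
    by (rule sum.swap)
  also have "\<dots> = v \<bullet>c (A *\<^sub>v w)"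
    using assms by (auto simp: scalar_prod_def atLeast0LessThan sum_distrib_left intro!: sum.cong)
  finally show ?thesis .
qed

text \<open>
  Gram--Schmidt, applied to a basis that starts with \<open>v\<close>, keeps \<open>v\<close> as its first vector;
  since it yields vectors that are orthogonal but not normalized, each is divided by its norm.
  The factor \<open>c\<close> is the reciprocal norm of \<open>v\<close>.
\<close>

lemma unitary_mat_with_first_col:
  fixes v :: "complex vec"
  assumes v: "v \<in> carrier_vec n" and v0: "v \<noteq> 0\<^sub>v n"
  obtains W c where "W \<in> carrier_mat n n" "mat_adjoint W * W = 1\<^sub>m n" "col W 0 = c \<cdot>\<^sub>v v"
proof -
  interpret cof_vec_space n "TYPE(complex)" .
  define ws where "ws = gram_schmidt n (basis_completion v)"
  note bc = basis_completion[OF v v0]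
  note gs = gram_schmidt_result[OF bc(2,4,5) ws_def]
  have len: "length ws = n"
    using gs bc by simp
  have n: "n > 0"
    using v v0 by (cases n) auto
  have hd: "ws ! 0 = v"
  proof -
    obtain vs where "basis_completion v = v # vs"
      using bc(6,7) n by (cases "basis_completion v") auto
    then have "hd ws = v" unfolding ws_def using v by simp
    then show ?thesis using len n by (cases ws) auto
  qed
  define N where "N w = complex_of_real (1 / sqrt (Re (w \<bullet>c w)))" for w :: "complex vec"
  have [simp]: "cnj (N w) = N w" for w
    by (simp add: N_def)
  let ?W = "mat n n (\<lambda>(i, j). N (ws ! j) * (ws ! j) $ i)"
  have wsc: "ws ! j \<in> carrier_vec n" if "j < n" for j
    using gs len that by auto
  have "mat_adjoint ?W * ?W = 1\<^sub>m n"
  proof (rule eq_matI)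
    fix i j assume "i < dim_row (1\<^sub>m n :: complex mat)" "j < dim_col (1\<^sub>m n :: complex mat)"
    then have ij: "i < n" "j < n" by auto
    have "(mat_adjoint ?W * ?W) $$ (i, j) = N (ws ! i) * N (ws ! j) * (ws ! j \<bullet>c ws ! i)"
      using ij wsc[OF ij(1)] wsc[OF ij(2)]
      by (auto simp: scalar_prod_def sum_distrib_left mult_ac intro!: sum.cong)
    also have "\<dots> = (if i = j then 1 else 0)"
    proof (cases "i = j")
      case False
      then show ?thesis
        using corthogonalD[OF gs(2)] len ij by auto
    next
      case True
      define x where "x = ws ! j \<bullet>c ws ! j"
      have "x \<noteq> 0" "x \<ge> 0"
        using corthogonalD[OF gs(2)] len ij True by (auto simp: x_def)
      then have "x = complex_of_real (Re x)" "Re x > 0"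
        by (auto simp: complex_eq_iff less_eq_complex_def)
      then obtain t where t: "x = complex_of_real t" "t > 0" by blast
      then show ?thesis
        using True by (simp add: N_def x_def[symmetric] flip: of_real_mult)
    qed
    finally show "(mat_adjoint ?W * ?W) $$ (i, j) = 1\<^sub>m n $$ (i, j)"
      using ij by simp
  qed auto
  moreover have "col ?W 0 = N v \<cdot>\<^sub>v v"
    using n v hd by (intro eq_vecI) auto
  ultimately show ?thesis
    by (intro that[of ?W "N v"]) auto
qed

lemma mat_adjoint_four_block_mat_diag:
  fixes A :: "complex mat"
  assumes "A \<in> carrier_mat k k" "D \<in> carrier_mat m m"
  shows "mat_adjoint (four_block_mat A (0\<^sub>m k m) (0\<^sub>m m k) D) =
    four_block_mat (mat_adjoint A) (0\<^sub>m k m) (0\<^sub>m m k) (mat_adjoint D)"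
  by (rule eq_matI) (use assms in auto)

text \<open>
  Induction on the dimension. If a unitary \<open>W\<close> has an eigenvector as its first column, then
  the first column of \<open>W\<^sup>* Z W\<close> is a multiple of the first unit vector. This matrix is Hermitian
  too, so its first row has the same shape, the eigenvalue is real, and the rest is a Hermitian
  block of smaller size. The induction hypothesis diagonalizes that block.
\<close>

lemma hermitian_spectral_decomposition:
  fixes Z :: "complex mat"
  assumes "Z \<in> carrier_mat n n" and "mat_adjoint Z = Z"
  shows "\<exists>U d. U \<in> carrier_mat n n \<and> mat_adjoint U * U = 1\<^sub>m n \<and>
    Z = U * mat_diag n (\<lambda>i. complex_of_real (d i)) * mat_adjoint U"
  using assms
proof (induction n arbitrary: Z)
  case 0
  then show ?case
    by (intro exI[of _ "1\<^sub>m 0"] exI[of _ "\<lambda>_. 0"]) auto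
next
  case (Suc m)
  let ?n = "Suc m"
  have Z: "Z \<in> carrier_mat ?n ?n" and herm: "mat_adjoint Z = Z"
    using Suc.prems by auto
  obtain \<mu> where "poly (char_poly Z) \<mu> = 0"
    using fundamental_theorem_of_algebra_alt[of "char_poly Z"] degree_monic_char_poly[OF Z]
    by (metis Zero_not_Suc degree_pCons_0)
  then have "eigenvalue Z \<mu>"
    using eigenvalue_root_char_poly[OF Z] by simp
  then obtain v where v: "v \<in> carrier_vec ?n" "v \<noteq> 0\<^sub>v ?n" "Z *\<^sub>v v = \<mu> \<cdot>\<^sub>v v"
    using Z by (auto simp: eigenvalue_def eigenvector_def)
  obtain W c where W: "W \<in> carrier_mat ?n ?n" "mat_adjoint W * W = 1\<^sub>m ?n"
    and W0: "col W 0 = c \<cdot>\<^sub>v v"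
    using unitary_mat_with_first_col[OF v(1,2)] by blast
  have colW: "col W 0 \<in> carrier_vec ?n"
    using W0 v(1) by simp
  have W': "mat_adjoint W \<in> carrier_mat ?n ?n"
    using W by simp
  have WW: "W * mat_adjoint W = 1\<^sub>m ?n"
    using mat_mult_left_right_inverse[OF W' W(1,2)] .
  define A where "A = mat_adjoint W * Z * W"
  have A: "A \<in> carrier_mat ?n ?n"
    using W W' Z unfolding A_def by (intro mult_carrier_mat)
  have hermA: "mat_adjoint A = A"
    unfolding A_def using W(1) W' Z herm
    by (simp add: mat_adjoint_mult[of _ ?n ?n _ ?n] assoc_mult_mat[of _ ?n ?n _ ?n _ ?n])
  have ZA: "Z = W * A * mat_adjoint W"
  proof -
    have "W * A * mat_adjoint W = (W * mat_adjoint W) * Z * (W * mat_adjoint W)"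
      unfolding A_def using W(1) W' Z
      by (simp add: assoc_mult_mat[of _ ?n ?n _ ?n _ ?n] mult_carrier_mat[of _ ?n ?n _ ?n])
    then show ?thesis using WW Z by simp
  qed
  have "col A 0 = \<mu> \<cdot>\<^sub>v unit_vec ?n 0"
  proof -
    have "col A 0 = (mat_adjoint W * Z) *\<^sub>v col W 0"
      unfolding A_def using W(1) W' Z by (intro col_mult2[of _ ?n ?n _ ?n]) auto
    also have "\<dots> = mat_adjoint W *\<^sub>v (Z *\<^sub>v col W 0)"
      using W(1) W' Z colW by (intro assoc_mult_mat_vec[of _ ?n ?n _ ?n]) auto
    also have "Z *\<^sub>v col W 0 = \<mu> \<cdot>\<^sub>v col W 0"
      unfolding W0 using v Z by (simp add: mult_mat_vec[of _ ?n ?n] smult_smult_assoc mult.commute)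
    also have "mat_adjoint W *\<^sub>v (\<mu> \<cdot>\<^sub>v col W 0) = \<mu> \<cdot>\<^sub>v (mat_adjoint W *\<^sub>v col W 0)"
      using W(1) W' colW by (intro mult_mat_vec[of _ ?n ?n]) auto
    also have "mat_adjoint W *\<^sub>v col W 0 = col (mat_adjoint W * W) 0"
      using W(1) W' by (intro col_mult2[symmetric, of _ ?n ?n _ ?n]) auto
    also have "\<dots> = unit_vec ?n 0"
      unfolding W(2) by simp
    finally show ?thesis .
  qed
  then have col0: "A $$ (i, 0) = (if i = 0 then \<mu> else 0)" if "i < ?n" for i
    using that A by (auto simp: vec_eq_iff)
  \<comment> \<open>The first row is the conjugate of the first column.\<close>
  have row0: "A $$ (0, i) = (if i = 0 then cnj \<mu> else 0)" if "i < ?n" for i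
    using col0[OF that] that A
    by (subst hermA[symmetric]) auto
  have real: "cnj \<mu> = \<mu>"
    using col0[of 0] row0[of 0] by simp
  then have \<mu>: "\<mu> = complex_of_real (Re \<mu>)"
    by (simp add: complex_eq_iff)
  define C where "C = mat m m (\<lambda>(i, j). A $$ (Suc i, Suc j))"
  have C: "C \<in> carrier_mat m m"
    by (simp add: C_def)
  have hermC: "mat_adjoint C = C"
    using A by (intro eq_matI) (auto simp: C_def, subst (2) hermA[symmetric], auto)
  obtain U d where U: "U \<in> carrier_mat m m" "mat_adjoint U * U = 1\<^sub>m m"
    and CU: "C = U * mat_diag m (\<lambda>i. complex_of_real (d i)) * mat_adjoint U"
    using Suc.IH[OF C hermC] by blast
  define L where "L = mat 1 1 (\<lambda>_. \<mu>)"
  have L: "L \<in> carrier_mat 1 1"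
    by (simp add: L_def)
  let ?V = "four_block_mat (1\<^sub>m 1) (0\<^sub>m 1 m) (0\<^sub>m m 1) U"
  let ?V' = "four_block_mat (1\<^sub>m 1) (0\<^sub>m 1 m) (0\<^sub>m m 1) (mat_adjoint U)"
  let ?e = "case_nat (Re \<mu>) d"
  let ?D = "mat_diag ?n (\<lambda>i. complex_of_real (?e i))"
  let ?D' = "mat_diag m (\<lambda>i. complex_of_real (d i))"
  have "mat_adjoint (1\<^sub>m 1 :: complex mat) = 1\<^sub>m 1"
    by (rule eq_matI) auto
  then have V': "mat_adjoint ?V = ?V'"
    using U by (simp add: mat_adjoint_four_block_mat_diag)
  have Vc: "?V \<in> carrier_mat ?n ?n" "?V' \<in> carrier_mat ?n ?n"
    using U four_block_carrier_mat[of "1\<^sub>m 1" 1 1 _ m m] by auto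
  have VV: "?V' * ?V = 1\<^sub>m ?n"
    using U by (subst mult_four_block_mat[of _ 1 1 _ m _ m _ _ 1 _ m]) auto
  have D: "?D = four_block_mat L (0\<^sub>m 1 m) (0\<^sub>m m 1) ?D'"
    using \<mu> by (intro eq_matI) (auto simp: mat_diag_def L_def split: nat.splits)
  have UD: "U * ?D' \<in> carrier_mat m m"
    using U by (intro mult_carrier_mat[of _ m m]) auto
  have "A = four_block_mat L (0\<^sub>m 1 m) (0\<^sub>m m 1) C"
    using A col0 row0 real by (intro eq_matI) (auto simp: L_def C_def)
  also have "\<dots> = four_block_mat L (0\<^sub>m 1 m) (0\<^sub>m m 1) (U * ?D') * ?V'"
    unfolding CU using U L UD mult_carrier_mat[OF UD, of "mat_adjoint U" m]
    by (subst mult_four_block_mat[of _ 1 1 _ m _ m _ _ 1 _ m]) (auto simp: right_mult_zero_mat[OF UD])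
  also have "four_block_mat L (0\<^sub>m 1 m) (0\<^sub>m m 1) (U * ?D') = ?V * ?D"
    unfolding D using U L
    by (subst mult_four_block_mat[of _ 1 1 _ m _ m _ _ 1 _ m])
      (auto simp: left_mult_zero_mat[of _ m m])
  finally have AV: "A = ?V * ?D * ?V'" .
  let ?U = "W * ?V"
  have Dc: "?D \<in> carrier_mat ?n ?n"
    by simp
  have U': "mat_adjoint ?U = ?V' * mat_adjoint W"
    using mat_adjoint_mult[OF W(1) Vc(1)] V' by simp
  have "mat_adjoint ?U * ?U = ?V' * (mat_adjoint W * W) * ?V"
    unfolding U' using W(1) W' Vc
    by (simp add: assoc_mult_mat[of _ ?n ?n _ ?n _ ?n] mult_carrier_mat[of _ ?n ?n _ ?n])
  also have "\<dots> = 1\<^sub>m ?n"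
    using VV right_mult_one_mat[OF Vc(2)] by (simp add: W(2))
  finally have "mat_adjoint ?U * ?U = 1\<^sub>m ?n" .
  moreover have "Z = ?U * ?D * mat_adjoint ?U"
    unfolding U' ZA AV using W(1) W' Vc Dc
    by (simp add: assoc_mult_mat[of _ ?n ?n _ ?n _ ?n] mult_carrier_mat[of _ ?n ?n _ ?n])
  moreover have "?U \<in> carrier_mat ?n ?n"
    using W(1) Vc by simp
  ultimately show ?case by blast
qed

section \<open>Counting eigenvalues by their sign\<close>

lemma char_poly_unitary_diagonalization:
  fixes U :: "complex mat"
  assumes U: "U \<in> carrier_mat n n" "mat_adjoint U * U = 1\<^sub>m n"
  shows "char_poly (U * mat_diag n f * mat_adjoint U) = (\<Prod>i<n. [:- f i, 1:])"
proof -
  have "U * mat_adjoint U = 1\<^sub>m n"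
    using mat_mult_left_right_inverse[of "mat_adjoint U" n U] U by simp
  then have "similar_mat_wit (U * mat_diag n f * mat_adjoint U) (mat_diag n f) U (mat_adjoint U)"
    using U by (intro similar_mat_witI[of _ _ n]) auto
  then have "char_poly (U * mat_diag n f * mat_adjoint U) = char_poly (mat_diag n f)"
    using char_poly_similar similar_mat_def by blast
  also have "\<dots> = (\<Prod>a\<leftarrow>diag_mat (mat_diag n f). [:- a, 1:])"
    by (rule char_poly_upper_triangular[of _ n]) (auto simp: mat_diag_def)
  also have "diag_mat (mat_diag n f) = map f [0..<n]"
    by (auto simp: diag_mat_def mat_diag_def)
  also have "(\<Prod>a\<leftarrow>map f [0..<n]. [:- a, 1:]) = (\<Prod>i<n. [:- f i, 1:])"
    by (simp add: o_def prod.distinct_set_conv_list[symmetric] atLeast0LessThan)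
  finally show ?thesis .
qed

lemma order_prod_linear_factors:
  fixes f :: "'b \<Rightarrow> 'a :: idom"
  assumes "finite I"
  shows "order x (\<Prod>i\<in>I. [:- f i, 1:]) = card {i \<in> I. f i = x}"
  using assms
proof (induction I)
  case empty
  then show ?case by (simp add: order_0I)
next
  case (insert j I)
  have nz: "(\<Prod>i\<in>I. [:- f i, 1:]) \<noteq> 0"
    using insert by (simp add: prod_zero_iff)
  have "order x (\<Prod>i\<in>insert j I. [:- f i, 1:]) = order x [:- f j, 1:] + card {i \<in> I. f i = x}"
    unfolding prod.insert[OF insert(1,2)] insert.IH[symmetric]
    by (rule order_mult) (use nz in \<open>auto simp del: mult_pCons_left\<close>)
  also have "order x [:- f j, 1:] = (if f j = x then 1 else 0)"
    using order_power_n_n[of x 1] by (auto intro: order_0I)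
  also have "\<dots> + card {i \<in> I. f i = x} = card {i \<in> insert j I. f i = x}"
  proof -
    have "{i \<in> insert j I. f i = x} = (if f j = x then insert j {i \<in> I. f i = x} else {i \<in> I. f i = x})"
      by auto
    then show ?thesis using insert by simp
  qed
  finally show ?case .
qed

text \<open>
  The order of a root \<open>x\<close> counts the indices \<open>i\<close> with \<open>d i = x\<close>, so summing the orders
  over the distinct roots that satisfy \<open>P\<close> counts the fibres of \<open>d\<close> over these roots.
\<close>

lemma sum_order_real_eigenvalues:
  fixes Z :: "complex mat"
  assumes Z: "Z \<in> carrier_mat n n"
    and cp: "char_poly Z = (\<Prod>i<n. [:- complex_of_real (d i), 1:])"
  shows "(\<Sum>x :: real | eigenvalue Z (complex_of_real x) \<and> P x. order (complex_of_real x) (char_poly Z)) =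
    card {i. i < n \<and> P (d i)}"
proof -
  have "eigenvalue Z (complex_of_real x) \<longleftrightarrow> x \<in> d ` {..<n}" for x
    unfolding eigenvalue_root_char_poly[OF Z] cp by (auto simp: poly_prod)
  then have set: "{x. eigenvalue Z (complex_of_real x) \<and> P x} = d ` {i. i < n \<and> P (d i)}"
    by auto
  have "order (complex_of_real x) (char_poly Z) = card {i \<in> {i. i < n \<and> P (d i)}. d i = x}"
    if "x \<in> d ` {i. i < n \<and> P (d i)}" for x
    unfolding cp order_prod_linear_factors[OF finite_lessThan]
    using that by (intro arg_cong[of _ _ card]) auto
  then have "(\<Sum>x | eigenvalue Z (complex_of_real x) \<and> P x. order (complex_of_real x) (char_poly Z)) =
    (\<Sum>x \<in> d ` {i. i < n \<and> P (d i)}. \<Sum>i | i \<in> {i. i < n \<and> P (d i)} \<and> d i = x. 1)"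
    unfolding set by simp
  also have "\<dots> = card {i. i < n \<and> P (d i)}"
    by (subst sum.image_gen[symmetric]) auto
  finally show ?thesis .
qed

section \<open>Matrices with a given Hermitian part\<close>

text \<open>
  The value of the form is \<open>\<Sum>i. d i * \<bar>w i\<bar>\<^sup>2\<close>. On vectors supported in \<open>J\<close> all summands have
  the same sign, so the sum vanishes only if each of them does.
\<close>

lemma diagonal_form_zero_imp_zero:
  assumes w: "w \<in> carrier_vec n" and supp: "\<And>i. i < n \<Longrightarrow> i \<notin> J \<Longrightarrow> w $ i = 0"
    and definite: "(\<forall>i\<in>J. d i > 0) \<or> (\<forall>i\<in>J. d i < 0)"
    and zero: "(mat_diag n (\<lambda>i. complex_of_real (d i)) *\<^sub>v w) \<bullet>c w = 0"
  shows "w = 0\<^sub>v n"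
proof -
  have "(mat_diag n (\<lambda>i. complex_of_real (d i)) *\<^sub>v w) \<bullet>c w =
      (\<Sum>i<n. complex_of_real (d i) * w $ i * cnj (w $ i))"
    using w by (auto simp: scalar_prod_def mat_diag_def atLeast0LessThan
        sum.delta if_distrib[of "\<lambda>x. x * _"] cong: if_cong intro!: sum.cong)
  also have "\<dots> = complex_of_real (\<Sum>i<n. d i * (cmod (w $ i))\<^sup>2)"
    by (simp add: complex_norm_square mult.assoc del: of_real_power)
  finally have sum: "(\<Sum>i<n. d i * (cmod (w $ i))\<^sup>2) = 0"
    using zero by (metis of_real_eq_0_iff)
  have "d i * (cmod (w $ i))\<^sup>2 = 0" if "i < n" for i
    using definite
  proof
    assume pos: "\<forall>i\<in>J. d i > 0"
    have "d i * (cmod (w $ i))\<^sup>2 \<ge> 0" if "i < n" for i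
      using pos supp[OF that] by (cases "i \<in> J") auto
    then show ?thesis
      using sum that by (subst (asm) sum_nonneg_eq_0_iff) auto
  next
    assume neg: "\<forall>i\<in>J. d i < 0"
    have "- (d i * (cmod (w $ i))\<^sup>2) \<ge> 0" if "i < n" for i
      using neg supp[OF that] by (cases "i \<in> J") (auto simp: mult_nonpos_nonneg)
    moreover have "(\<Sum>i<n. - (d i * (cmod (w $ i))\<^sup>2)) = 0"
      using sum by (simp add: sum_negf)
    ultimately show ?thesis
      using that by (subst (asm) sum_nonneg_eq_0_iff) auto
  qed
  moreover have "d i \<noteq> 0" if "i \<in> J" for i
    using definite that by fastforce
  ultimately have "w $ i = 0" if "i < n" for i
    using that supp by (cases "i \<in> J") fastforce+
  then show ?thesis
    using w by (intro eq_vecI) auto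
qed

text \<open>
  If \<open>S x = 0\<close>, then \<open>x\<^sup>* (S + S\<^sup>*) x = x\<^sup>* (S x) + (S x)\<^sup>* x = 0\<close>. The span of the columns of
  \<open>U\<close> with index in \<open>J\<close> is a subspace of dimension \<open>card J\<close> on which the form is definite, so
  it meets the kernel of \<open>S\<close> only in \<open>0\<close> and its dimension is at most \<open>rank S\<close>. To avoid the
  dimensions of kernels, a rank factorization \<open>S = A * B\<close> produces a common nonzero vector:
  if \<open>rank S < card J\<close>, then \<open>B * U\<close> kills a nonzero \<open>w\<close> supported in \<open>J\<close>, and \<open>x = U w\<close>.
\<close>

lemma definite_index_set_card_le_rank:
  fixes S U :: "complex mat"
  assumes S: "S \<in> carrier_mat n n" and U: "U \<in> carrier_mat n n" "mat_adjoint U * U = 1\<^sub>m n"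
    and eq: "U * mat_diag n (\<lambda>i. complex_of_real (d i)) * mat_adjoint U = S + mat_adjoint S"
    and J: "J \<subseteq> {..<n}"
    and definite: "(\<forall>i\<in>J. d i > 0) \<or> (\<forall>i\<in>J. d i < 0)"
  shows "card J \<le> vec_space.rank n S"
proof (rule ccontr)
  let ?r = "vec_space.rank n S"
  let ?D = "mat_diag n (\<lambda>i. complex_of_real (d i))"
  assume "\<not> card J \<le> ?r"
  then have less: "?r < card J" by simp
  obtain A B where A: "A \<in> carrier_mat n ?r" and B: "B \<in> carrier_mat ?r n" and SAB: "S = A * B"
    by (rule rank_factorization[OF S])
  have "B * U \<in> carrier_mat ?r n"
    using B U by simp
  then obtain w where w: "w \<in> carrier_vec n" "w \<noteq> 0\<^sub>v n"
    "\<And>i. i < n \<Longrightarrow> i \<notin> J \<Longrightarrow> w $ i = 0" "(B * U) *\<^sub>v w = 0\<^sub>v ?r"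
    using supported_kernel_vector[OF _ J less] by blast
  define x where "x = U *\<^sub>v w"
  have x: "x \<in> carrier_vec n"
    using U w by (simp add: x_def)
  have "S *\<^sub>v x = A *\<^sub>v ((B * U) *\<^sub>v w)"
    unfolding SAB x_def using A B U(1) w(1)
    by (simp add: assoc_mult_mat_vec[of _ n ?r _ n] assoc_mult_mat_vec[of _ ?r n _ n])
  then have Sx: "S *\<^sub>v x = 0\<^sub>v n"
    using w(4) A by auto
  have "((S + mat_adjoint S) *\<^sub>v x) \<bullet>c x = (S *\<^sub>v x) \<bullet>c x + (mat_adjoint S *\<^sub>v x) \<bullet>c x"
    using S x by (simp add: add_mult_distrib_mat_vec[of _ n n] add_scalar_prod_distrib[of _ n]
        mult_mat_vec_carrier[of _ n n])
  also have "(mat_adjoint S *\<^sub>v x) \<bullet>c x = x \<bullet>c (S *\<^sub>v x)"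
    by (rule adjoint_cscalar_prod[OF S x x])
  finally have zero: "((S + mat_adjoint S) *\<^sub>v x) \<bullet>c x = 0"
    using Sx x by simp
  have Ux: "mat_adjoint U *\<^sub>v x = w"
    unfolding x_def using U w(1)
    by (subst assoc_mult_mat_vec[symmetric, of _ n n _ n]) auto
  have "(?D *\<^sub>v w) \<bullet>c w = (mat_adjoint (mat_adjoint U) *\<^sub>v (?D *\<^sub>v w)) \<bullet>c x"
    using U w x by (subst adjoint_cscalar_prod[of _ n n]) (auto simp: Ux intro!: mult_mat_vec_carrier[of _ n n])
  also have "mat_adjoint (mat_adjoint U) *\<^sub>v (?D *\<^sub>v w) = (S + mat_adjoint S) *\<^sub>v x"
    unfolding eq[symmetric] Ux[symmetric] using U(1) x
    by (simp add: assoc_mult_mat_vec[of _ n n _ n] assoc_mult_mat[of _ n n _ n _ n] mult_mat_vec_carrier[of _ n n]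
        mult_carrier_mat[of _ n n _ n])
  finally have "(?D *\<^sub>v w) \<bullet>c w = 0"
    using zero by simp
  then have "w = 0\<^sub>v n"
    using diagonal_form_zero_imp_zero[OF w(1,3) definite] by blast
  with w(2) show False by simp
qed

text \<open>
  For single vectors the identity
  \<open>a a\<^sup>* - b b\<^sup>* = ((a + b) (a - b)\<^sup>* + (a - b) (a + b)\<^sup>*) / 2\<close> writes the difference of two squares
  as \<open>s + s\<^sup>*\<close>, where \<open>s = (a + b) (a - b)\<^sup>* / 2\<close> has rank at most one. So a single matrix of
  rank one takes care of one positive and one negative square at the same time.
\<close>

lemma low_rank_splitting:
  fixes Z :: "complex mat" and a b :: "nat \<Rightarrow> nat \<Rightarrow> complex"
  assumes Z: "Z \<in> carrier_mat n n"
    and entries: "\<And>i j. i < n \<Longrightarrow> j < n \<Longrightarrow>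
      Z $$ (i, j) = (\<Sum>k<m. a i k * cnj (a j k) - b i k * cnj (b j k))"
  obtains S where "S \<in> carrier_mat n n" "Z = S + mat_adjoint S" "vec_space.rank n S \<le> m"
proof -
  define S where "S = mat n n (\<lambda>(i, j). \<Sum>k<m. (a i k + b i k) * (cnj (a j k - b j k) / 2))"
  have "Z = S + mat_adjoint S"
  proof (rule eq_matI)
    fix i j assume "i < dim_row (S + mat_adjoint S)" "j < dim_col (S + mat_adjoint S)"
    then have ij: "i < n" "j < n" by (auto simp: S_def)
    have "(S + mat_adjoint S) $$ (i, j) =
      (\<Sum>k<m. (a i k + b i k) * (cnj (a j k - b j k) / 2) + cnj ((a j k + b j k) * (cnj (a i k - b i k) / 2)))"
      using ij by (simp add: S_def sum.distrib)
    also have "\<dots> = Z $$ (i, j)"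
      unfolding entries[OF ij] by (intro sum.cong) (auto simp: field_simps)
    finally show "Z $$ (i, j) = (S + mat_adjoint S) $$ (i, j)" ..
  qed (use Z in \<open>auto simp: S_def\<close>)
  moreover have "vec_space.rank n S \<le> m"
    unfolding S_def by (rule sum_of_rank_one_rank_le)
  ultimately show ?thesis
    by (intro that[of S]) (auto simp: S_def)
qed

lemma sum_over_padded_enumeration:
  fixes g :: "nat \<Rightarrow> 'a :: comm_monoid_add"
  assumes "bij_betw e {..<card J} J" "card J \<le> m"
  shows "(\<Sum>k<m. if k < card J then g (e k) else 0) = (\<Sum>l\<in>J. g l)"
proof -
  have "(\<Sum>k<m. if k < card J then g (e k) else 0) = (\<Sum>k<card J. g (e k))"
    using assms(2) by (intro sum.mono_neutral_cong_right) auto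
  also have "\<dots> = (\<Sum>l\<in>J. g l)"
    by (rule sum.reindex_bij_betw[OF assms(1)])
  finally show ?thesis .
qed

text \<open>
  The spectral decomposition expresses \<open>Z\<close> as a sum of squares \<open>u u\<^sup>*\<close> for the positive eigenvalues
  minus such a sum for the negative ones, where \<open>u\<close> is a column of \<open>U\<close> scaled by the square root of
  the absolute value of its eigenvalue. The two lists are enumerated by \<open>e\<close> and \<open>f\<close> and paired
  off; the shorter one is padded with zero vectors.
\<close>

lemma splitting_of_rank_max_inertia:
  fixes U :: "complex mat" and d :: "nat \<Rightarrow> real"
  assumes U: "U \<in> carrier_mat n n"
    and Z: "Z = U * mat_diag n (\<lambda>i. complex_of_real (d i)) * mat_adjoint U"
  obtains S where "S \<in> carrier_mat n n" "Z = S + mat_adjoint S"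
    "vec_space.rank n S \<le> max (card {i. i < n \<and> d i > 0}) (card {i. i < n \<and> d i < 0})"
proof -
  let ?I = "{i. i < n \<and> d i > 0}" and ?J = "{i. i < n \<and> d i < 0}"
  let ?m = "max (card ?I) (card ?J)"
  obtain e where e: "bij_betw e {..<card ?I} ?I"
    using ex_bij_betw_nat_finite[of ?I] by (auto simp: atLeast0LessThan)
  obtain f where f: "bij_betw f {..<card ?J} ?J"
    using ex_bij_betw_nat_finite[of ?J] by (auto simp: atLeast0LessThan)
  let ?u = "\<lambda>i l. complex_of_real (sqrt \<bar>d l\<bar>) * U $$ (i, l)"
  let ?a = "\<lambda>i k. if k < card ?I then ?u i (e k) else 0"
  let ?b = "\<lambda>i k. if k < card ?J then ?u i (f k) else 0"
  have u: "?u i l * cnj (?u j l) = complex_of_real \<bar>d l\<bar> * (U $$ (i, l) * cnj (U $$ (j, l)))" for i j l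
  proof -
    have "?u i l * cnj (?u j l) =
      complex_of_real (sqrt \<bar>d l\<bar> * sqrt \<bar>d l\<bar>) * (U $$ (i, l) * cnj (U $$ (j, l)))"
      unfolding of_real_mult by (simp add: mult_ac)
    then show ?thesis by simp
  qed
  have Zc: "Z \<in> carrier_mat n n"
    unfolding Z using U by (intro mult_carrier_mat[of _ n n]) auto
  have "Z $$ (i, j) = (\<Sum>k<?m. ?a i k * cnj (?a j k) - ?b i k * cnj (?b j k))"
    if ij: "i < n" "j < n" for i j
  proof -
    let ?t = "\<lambda>l. U $$ (i, l) * cnj (U $$ (j, l))"
    have "(\<Sum>k<?m. ?a i k * cnj (?a j k) - ?b i k * cnj (?b j k)) =
      (\<Sum>k<?m. if k < card ?I then ?u i (e k) * cnj (?u j (e k)) else 0) -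
      (\<Sum>k<?m. if k < card ?J then ?u i (f k) * cnj (?u j (f k)) else 0)"
      unfolding sum_subtractf[symmetric] by (intro sum.cong) auto
    also have "\<dots> = (\<Sum>l\<in>?I. ?u i l * cnj (?u j l)) - (\<Sum>l\<in>?J. ?u i l * cnj (?u j l))"
      using sum_over_padded_enumeration[OF e, of ?m "\<lambda>l. ?u i l * cnj (?u j l)"]
        sum_over_padded_enumeration[OF f, of ?m "\<lambda>l. ?u i l * cnj (?u j l)"] by simp
    also have "\<dots> = (\<Sum>l\<in>?I. complex_of_real (d l) * ?t l) + (\<Sum>l\<in>?J. complex_of_real (d l) * ?t l)"
      unfolding u by (simp add: sum_negf[symmetric])
    also have "\<dots> = (\<Sum>l\<in>?I \<union> ?J. complex_of_real (d l) * ?t l)"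
      by (rule sum.union_disjoint[symmetric]) auto
    also have "\<dots> = (\<Sum>l<n. complex_of_real (d l) * ?t l)"
      by (rule sum.mono_neutral_left) (auto simp: not_less)
    also have "\<dots> = Z $$ (i, j)"
      unfolding Z using U ij
      by (subst mat_diag_mult_right[of _ n n])
        (auto simp: scalar_prod_def atLeast0LessThan mult_ac intro!: sum.cong)
    finally show ?thesis ..
  qed
  from low_rank_splitting[OF Zc this] that show ?thesis by blast
qed

theorem proposition2:
  fixes Z :: "complex mat" and n p q d :: nat
  assumes "Z \<in> carrier_mat n n"
    and "hermitian_mat Z"
    and "signature Z = (p, q, d)"
  defines "R \<equiv> {vec_space.rank n S | S. S \<in> carrier_mat n n \<and> Z = S + mat_adjoint S}"
  shows "finite R \<and> R \<noteq> {} \<and> Min R = max p q"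
proof -
  have "mat_adjoint Z = Z"
    using assms(2) by (simp add: hermitian_mat_def)
  from hermitian_spectral_decomposition[OF assms(1) this]
  obtain U ev where U: "U \<in> carrier_mat n n" "mat_adjoint U * U = 1\<^sub>m n"
    and Z: "Z = U * mat_diag n (\<lambda>i. complex_of_real (ev i)) * mat_adjoint U"
    by blast
  have cp: "char_poly Z = (\<Prod>i<n. [:- complex_of_real (ev i), 1:])"
    unfolding Z by (rule char_poly_unitary_diagonalization[OF U])
  have p: "p = card {i. i < n \<and> ev i > 0}" and q: "q = card {i. i < n \<and> ev i < 0}"
    using assms(3) sum_order_real_eigenvalues[OF assms(1) cp]
    by (simp_all add: signature_def pos_eigenvalues_count_def neg_eigenvalues_count_def)
  have lower: "max p q \<le> vec_space.rank n S"
    if S: "S \<in> carrier_mat n n" "Z = S + mat_adjoint S" for S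
  proof -
    have eq: "U * mat_diag n (\<lambda>i. complex_of_real (ev i)) * mat_adjoint U = S + mat_adjoint S"
      using S(2) Z by simp
    show ?thesis
      unfolding p q max.bounded_iff
      by (intro conjI definite_index_set_card_le_rank[OF S(1) U eq]) auto
  qed
  obtain S where S: "S \<in> carrier_mat n n" "Z = S + mat_adjoint S" "vec_space.rank n S \<le> max p q"
    using splitting_of_rank_max_inertia[OF U(1) Z] unfolding p q by blast
  then have attained: "max p q \<in> R"
    using lower[OF S(1,2)] unfolding R_def by force
  have "R \<subseteq> {..n}"
    unfolding R_def using vec_space.rank_le_nc by auto
  then have "finite R"
    using finite_subset by blast
  moreover have "Min R = max p q"
    by (rule Min_eqI[OF \<open>finite R\<close> _ attained]) (use lower in \<open>auto simp: R_def\<close>)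
  ultimately show ?thesis
    using attained by blast
qed

end
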